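(* For each $i\in\{1,2\}$, let $X_i$ be a Banach space and let $V_i$ be a non-empty closed convex subset of $X_i$ such that $(X_i,V_i,\mathcal{CB}(X_i))$ has property-$(P_1)$. Let $X=X_1\oplus_\infty X_2$ and $V=V_1\times V_2$. If for each $i\in\{1,2\}$ the map $\mathrm{cent}_{V_i}(\cdot)$ is Hausdorff metric continuous on $\mathcal{CB}(X_i)$, then $\mathrm{cent}_V(\cdot)$ is Hausdorff metric continuous on $\mathcal{CB}(X)$.
   Context: All Banach spaces are real. $X_1\oplus_\infty X_2$ is $X_1\times X_2$ with the norm $\|(x_1,x_2)\|=\max\{\|x_1\|,\|x_2\|\}$. For a Banach space $E$, $B_E$ is its closed unit ball and $\mathcal{CB}(E)$ is the class of non-empty closed bounded subsets of $E$, equipped with the Hausdorff metric $d_H(A,B)=\inf\{t>0: A\subseteq B+tB_E,\ B\subseteq A+tB_E\}$. For $v\in E$ and a non-empty bounded set $F\subseteq E$, $r(v,F)=\sup_{z\in F}\|v-z\|$. For a non-empty closed convex $V\subseteq E$: $\mathrm{rad}_V(F)=\inf_{v\in V}r(v,F)$, $\mathrm{cent}_V(F)=\{v\in V: r(v,F)=\mathrm{rad}_V(F)\}$, and for $\delta>0$, $\mathrm{cent}_V(F,\delta)=\{v\in V: r(v,F)\le \mathrm{rad}_V(F)+\delta\}$. For $\mathscr F\subseteq\mathcal{CB}(E)$, the pair $(V,\mathscr F)$ has the restricted center property (r.c.p.) if $\mathrm{cent}_V(F)\ne\emptyset$ for every $F\in\mathscr F$. The triplet $(E,V,\mathscr F)$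 has property-$(P_1)$ if $(V,\mathscr F)$ has r.c.p. and for every $\varepsilon>0$ and $F\in\mathscr F$ there is $\delta>0$ with $\mathrm{cent}_V(F,\delta)\subseteq\mathrm{cent}_V(F)+\varepsilon B_E$. The map $\mathrm{cent}_V(\cdot)$ is Hausdorff metric continuous on $\mathcal{CB}(E)$ if it takes values in $\mathcal{CB}(E)$ (in particular non-empty values) and is continuous as a single-valued map from $(\mathcal{CB}(E),d_H)$ to $(\mathcal{CB}(E),d_H)$. *)

theory Defs
  imports "HOL-Analysis.Analysis"
begin

text \<open>The library equips the product type with the Euclidean norm of the pair of norms, so
  the direct sum with the maximum norm needs a type of its own.\<close>

datatype ('a, 'b) sup_sum = SupPair (sfst: 'a) (ssnd: 'b)

instantiation sup_sum :: (real_vector, real_vector) real_vector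
begin

definition "0 = SupPair 0 0"
definition "x + y = SupPair (sfst x + sfst y) (ssnd x + ssnd y)"
definition "- x = SupPair (- sfst x) (- ssnd x)"
definition "x - y = SupPair (sfst x - sfst y) (ssnd x - ssnd y)"
definition "c *\<^sub>R x = SupPair (c *\<^sub>R sfst x) (c *\<^sub>R ssnd x)"

instance
  by standard
    (simp_all add: zero_sup_sum_def plus_sup_sum_def uminus_sup_sum_def minus_sup_sum_def
      scaleR_sup_sum_def algebra_simps)

end

lemma sup_sum_sel [simp]:
  "sfst 0 = 0" "ssnd 0 = 0"
  "sfst (x + y) = sfst x + sfst y" "ssnd (x + y) = ssnd x + ssnd y"
  "sfst (- x) = - sfst x" "ssnd (- x) = - ssnd x"
  "sfst (x - y) = sfst x - sfst y" "ssnd (x - y) = ssnd x - ssnd y"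
  "sfst (c *\<^sub>R x) = c *\<^sub>R sfst x" "ssnd (c *\<^sub>R x) = c *\<^sub>R ssnd x"
  by (simp_all add: zero_sup_sum_def plus_sup_sum_def uminus_sup_sum_def minus_sup_sum_def
      scaleR_sup_sum_def)

instantiation sup_sum :: (real_normed_vector, real_normed_vector) real_normed_vector
begin

definition norm_sup_sum :: "('a, 'b) sup_sum \<Rightarrow> real"
  where "norm x = max (norm (sfst x)) (norm (ssnd x))"

definition dist_sup_sum :: "('a, 'b) sup_sum \<Rightarrow> ('a, 'b) sup_sum \<Rightarrow> real"
  where "dist x y = norm (x - y :: ('a, 'b) sup_sum)"

definition sgn_sup_sum :: "('a, 'b) sup_sum \<Rightarrow> ('a, 'b) sup_sum"
  where "sgn x = x /\<^sub>R norm (x :: ('a, 'b) sup_sum)"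

definition uniformity_sup_sum :: "(('a, 'b) sup_sum \<times> ('a, 'b) sup_sum) filter"
  where "uniformity = (INF e\<in>{0 <..}. principal {(x :: ('a, 'b) sup_sum, y). dist x y < e})"

definition open_sup_sum :: "('a, 'b) sup_sum set \<Rightarrow> bool"
  where "open (U :: ('a, 'b) sup_sum set) \<longleftrightarrow> (\<forall>x\<in>U. \<forall>\<^sub>F (x', y) in uniformity. x' = x \<longrightarrow> y \<in> U)"

instance
proof
  fix x y :: "('a, 'b) sup_sum" and c :: real and U :: "('a, 'b) sup_sum set"
  show "norm x = 0 \<longleftrightarrow> x = 0"
    by (cases x) (auto simp: norm_sup_sum_def zero_sup_sum_def max_def split: if_splits)
  show "norm (x + y) \<le> norm x + norm y"
    using norm_triangle_ineq[of "sfst x" "sfst y"] norm_triangle_ineq[of "ssnd x" "ssnd y"]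
    unfolding norm_sup_sum_def sup_sum_sel by linarith
  show "norm (c *\<^sub>R x) = \<bar>c\<bar> * norm x"
    by (simp add: norm_sup_sum_def max_mult_distrib_left)
qed (simp_all add: dist_sup_sum_def sgn_sup_sum_def uniformity_sup_sum_def open_sup_sum_def)

end

instance sup_sum :: (banach, banach) banach
proof
  fix X :: "nat \<Rightarrow> ('a, 'b) sup_sum"
  assume X: "Cauchy X"
  have "Cauchy (\<lambda>n. sfst (X n))" "Cauchy (\<lambda>n. ssnd (X n))"
    using X by (fastforce simp: Cauchy_def dist_norm norm_sup_sum_def)+
  then obtain a b where a: "(\<lambda>n. sfst (X n)) \<longlonglongrightarrow> a" and b: "(\<lambda>n. ssnd (X n)) \<longlonglongrightarrow> b"
    by (meson Cauchy_convergent convergent_def)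
  have "X \<longlonglongrightarrow> SupPair a b"
  proof (rule tendstoI)
    fix e :: real
    assume "e > 0"
    with tendstoD[OF a] tendstoD[OF b]
    have "\<forall>\<^sub>F n in sequentially. dist (sfst (X n)) a < e \<and> dist (ssnd (X n)) b < e"
      by (simp add: eventually_conj)
    then show "\<forall>\<^sub>F n in sequentially. dist (X n) (SupPair a b) < e"
      by (simp add: dist_norm norm_sup_sum_def)
  qed
  then show "convergent X"
    by (rule convergentI)
qed

definition sup_Times :: "'a set \<Rightarrow> 'b set \<Rightarrow> ('a, 'b) sup_sum set" (infixr "\<times>\<^sub>\<infinity>" 80)
  where "A \<times>\<^sub>\<infinity> B = {SupPair a b | a b. a \<in> A \<and> b \<in> B}"

definition CB :: "'a::real_normed_vector set set"
  where "CB = {A. A \<noteq> {} \<and> closed A \<and> bounded A}"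

text \<open>\<open>enlarge A t\<close> is the set $A + tB_E$.\<close>

definition enlarge :: "'a::real_normed_vector set \<Rightarrow> real \<Rightarrow> 'a set"
  where "enlarge A t = {a + t *\<^sub>R u | a u. a \<in> A \<and> u \<in> cball 0 1}"

definition hausdorff_dist :: "'a::real_normed_vector set \<Rightarrow> 'a set \<Rightarrow> real"
  where "hausdorff_dist A B = Inf {t. t > 0 \<and> A \<subseteq> enlarge B t \<and> B \<subseteq> enlarge A t}"

definition hausdorff_continuous_on_CB :: "('a::real_normed_vector set \<Rightarrow> 'a set) \<Rightarrow> bool"
  where "hausdorff_continuous_on_CB \<Phi> \<longleftrightarrow>
    (\<forall>F\<in>CB. \<Phi> F \<in> CB) \<and>
    (\<forall>F\<in>CB. \<forall>\<epsilon>>0. \<exists>\<delta>>0. \<forall>G\<in>CB.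
      hausdorff_dist G F < \<delta> \<longrightarrow> hausdorff_dist (\<Phi> G) (\<Phi> F) < \<epsilon>)"

text \<open>The suprema and infima below are taken in the reals; they are the intended ones when
  \<open>F\<close> is non-empty and bounded and \<open>V\<close> is non-empty.\<close>

definition far_dist :: "'a::real_normed_vector \<Rightarrow> 'a set \<Rightarrow> real"
  where "far_dist v F = (SUP z\<in>F. norm (v - z))"

definition rad :: "'a::real_normed_vector set \<Rightarrow> 'a set \<Rightarrow> real"
  where "rad V F = (INF v\<in>V. far_dist v F)"

definition cent :: "'a::real_normed_vector set \<Rightarrow> 'a set \<Rightarrow> 'a set"
  where "cent V F = {v \<in> V. far_dist v F = rad V F}"

definition near_cent :: "'a::real_normed_vector set \<Rightarrow> 'a set \<Rightarrow> real \<Rightarrow> 'a set"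
  where "near_cent V F \<delta> = {v \<in> V. far_dist v F \<le> rad V F + \<delta>}"

definition rcp :: "'a::real_normed_vector set \<Rightarrow> 'a set set \<Rightarrow> bool"
  where "rcp V \<F> \<longleftrightarrow> (\<forall>F\<in>\<F>. cent V F \<noteq> {})"

definition property_P1 :: "'a::real_normed_vector set \<Rightarrow> 'a set set \<Rightarrow> bool"
  where "property_P1 V \<F> \<longleftrightarrow> rcp V \<F> \<and>
    (\<forall>\<epsilon>>0. \<forall>F\<in>\<F>. \<exists>\<delta>>0. near_cent V F \<delta> \<subseteq> enlarge (cent V F) \<epsilon>)"

end

theory Submission
  imports Defs
begin

text \<open>For a closed bounded \<open>F\<close> in the sum let \<open>F\<^sub>i\<close> be the closure of its \<open>i\<close>-th projection. The
  farthest distance splits as the maximum of the farthest distances to \<open>F\<^sub>1\<close> and \<open>F\<^sub>2\<close>, so with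
  \<open>R\<close> the larger of the two radii, the center of \<open>F\<close> is the product of the sublevel sets
  \<open>{v \<in> V\<^sub>i. r(v, F\<^sub>i) \<le> R}\<close>. It remains to see that such a sublevel set depends continuously on
  \<open>(F\<^sub>i, R)\<close>. At \<open>R = rad F\<^sub>i\<close> this is property \<open>(P\<^sub>1)\<close> for one inclusion and continuity of the center
  map for the other; at \<open>R > rad F\<^sub>i\<close> a point slightly above the level is pushed below it by
  moving it a little along the segment towards a center of \<open>F\<^sub>i\<close>.\<close>

section \<open>Hausdorff distance\<close>

lemma CB_D:
  assumes "F \<in> CB"
  shows "F \<noteq> {}" "closed F" "bounded F"
  using assms by (auto simp: CB_def)

text \<open>Dividing by \<open>t > 0\<close> turns a displacement of norm at most \<open>t\<close>
  into a vector of the unit ball. As the ball is closed, the nearby point of \<open>A\<close> comes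
  with a non-strict bound.\<close>

lemma mem_enlarge_iff:
  assumes "t > 0"
  shows "x \<in> enlarge A t \<longleftrightarrow> (\<exists>a\<in>A. norm (x - a) \<le> t)"
proof
  assume "x \<in> enlarge A t"
  then obtain a u where "a \<in> A" "norm u \<le> 1" "x = a + t *\<^sub>R u"
    by (auto simp: enlarge_def)
  then show "\<exists>a\<in>A. norm (x - a) \<le> t"
    using assms by (intro bexI[of _ a]) (auto simp: mult_left_le)
next
  assume "\<exists>a\<in>A. norm (x - a) \<le> t"
  then obtain a where a: "a \<in> A" "norm (x - a) \<le> t"
    by blast
  have "norm ((x - a) /\<^sub>R t) = norm (x - a) / t"
    using assms by (simp only: norm_scaleR) (simp add: field_simps)
  then have "x = a + t *\<^sub>R ((x - a) /\<^sub>R t)" "(x - a) /\<^sub>R t \<in> cball 0 1"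
    using a assms by (simp_all del: scaleR_diff_right)
  with a show "x \<in> enlarge A t"
    unfolding enlarge_def by blast
qed

lemma enlarge_mono:
  assumes "A \<subseteq> B" "0 < s" "s \<le> t"
  shows "enlarge A s \<subseteq> enlarge B t"
proof
  fix x
  assume "x \<in> enlarge A s"
  then obtain a where "a \<in> A" "norm (x - a) \<le> s"
    using assms by (auto simp: mem_enlarge_iff)
  with assms show "x \<in> enlarge B t"
    by (auto simp: mem_enlarge_iff intro!: bexI[of _ a])
qed

text \<open>Ensures that the set of admissible \<open>t\<close> in \<open>hausdorff_dist\<close> is
  non-empty on \<open>CB\<close>, so that its real infimum is genuine.\<close>

lemma bounded_subset_enlarge:
  assumes "bounded A" "B \<noteq> {}"
  shows "\<exists>t>0. A \<subseteq> enlarge B t"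
proof -
  obtain b where b: "b \<in> B"
    using assms by blast
  obtain t where t: "t > 0" "A \<subseteq> ball b t"
    using bounded_subset_ballD[OF assms(1)] by blast
  have "A \<subseteq> enlarge B t"
  proof
    fix x
    assume "x \<in> A"
    then have "norm (x - b) \<le> t"
      using t by (auto simp: dist_norm norm_minus_commute intro: less_imp_le)
    with b t(1) show "x \<in> enlarge B t"
      by (auto simp: mem_enlarge_iff)
  qed
  with t show ?thesis
    by blast
qed

lemma hausdorff_dist_le:
  assumes "t > 0" "A \<subseteq> enlarge B t" "B \<subseteq> enlarge A t"
  shows "hausdorff_dist A B \<le> t"
  unfolding hausdorff_dist_def using assms
  by (intro cInf_lower bdd_belowI[of _ 0]) auto

lemma hausdorff_dist_lessD:
  assumes "A \<in> CB" "B \<in> CB" "hausdorff_dist A B < d"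
  shows "\<exists>t>0. t < d \<and> A \<subseteq> enlarge B t \<and> B \<subseteq> enlarge A t"
proof -
  obtain s t where st: "s > 0" "A \<subseteq> enlarge B s" "t > 0" "B \<subseteq> enlarge A t"
    using bounded_subset_enlarge[of A B] bounded_subset_enlarge[of B A] CB_D[OF assms(1)] CB_D[OF assms(2)]
    by metis
  have "enlarge B s \<subseteq> enlarge B (max s t)" "enlarge A t \<subseteq> enlarge A (max s t)"
    using st by (intro enlarge_mono; simp)+
  then have "max s t \<in> {t. t > 0 \<and> A \<subseteq> enlarge B t \<and> B \<subseteq> enlarge A t}"
    using st by auto
  then have "{t. t > 0 \<and> A \<subseteq> enlarge B t \<and> B \<subseteq> enlarge A t} \<noteq> {}"
    by blast
  from cInf_lessD[OF this] show ?thesis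
    using assms(3) unfolding hausdorff_dist_def by blast
qed

section \<open>Farthest distance and its sublevel sets\<close>

text \<open>Non-emptiness and boundedness make the real supremum genuine; later estimates of
  \<open>far_dist\<close> go through this pointwise form.\<close>

lemma far_dist_le_iff:
  assumes "F \<noteq> {}" "bounded F"
  shows "far_dist v F \<le> R \<longleftrightarrow> (\<forall>z\<in>F. norm (v - z) \<le> R)"
proof -
  obtain e where "\<forall>z\<in>F. dist v z \<le> e"
    using assms(2) bounded_any_center by blast
  then have "bdd_above ((\<lambda>z. norm (v - z)) ` F)"
    by (auto simp: dist_norm intro: bdd_aboveI2)
  then show ?thesis
    unfolding far_dist_def using assms(1) by (rule cSUP_le_iff[rotated])
qed

lemma norm_le_far_dist:
  assumes "bounded F" "z \<in> F"
  shows "norm (v - z) \<le> far_dist v F"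
  using far_dist_le_iff[of F v "far_dist v F"] assms by blast

lemma far_dist_nonneg:
  assumes "F \<noteq> {}" "bounded F"
  shows "0 \<le> far_dist v F"
  using assms norm_le_far_dist[of F _ v] by (meson all_not_in_conv norm_ge_zero order_trans)

lemma rad_le:
  assumes "F \<in> CB" "v \<in> V"
  shows "rad V F \<le> far_dist v F"
  unfolding rad_def using assms
  by (intro cINF_lower bdd_belowI2[of _ 0]) (auto simp: far_dist_nonneg CB_D)

lemma far_dist_enlarge:
  assumes "F \<in> CB" "G \<in> CB" "t > 0" "F \<subseteq> enlarge G t"
  shows "far_dist v F \<le> far_dist v G + t"
proof -
  have "norm (v - z) \<le> far_dist v G + t" if "z \<in> F" for z
  proof -
    have "z \<in> enlarge G t"
      using assms(4) that by blast
    then obtain g where g: "g \<in> G" "norm (z - g) \<le> t"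
      using assms(3) by (auto simp: mem_enlarge_iff)
    have "norm (v - z) \<le> norm (v - g) + norm (z - g)"
      using norm_triangle_ineq4[of "v - g" "z - g"] by simp
    then show ?thesis
      using g norm_le_far_dist[of G g v] CB_D[OF assms(2)] by linarith
  qed
  then show ?thesis
    using CB_D[OF assms(1)] by (simp add: far_dist_le_iff)
qed

text \<open>A center of \<open>G\<close> serves as a competitor for the radius of
  \<open>F\<close>.\<close>

lemma rad_enlarge:
  assumes "F \<in> CB" "G \<in> CB" "t > 0" "F \<subseteq> enlarge G t" "cent V G \<noteq> {}"
  shows "rad V F \<le> rad V G + t"
proof -
  obtain c where "c \<in> V" "far_dist c G = rad V G"
    using assms(5) by (auto simp: cent_def)
  then show ?thesis
    using rad_le[OF assms(1), of c V] far_dist_enlarge[OF assms(1-4), of c] by linarith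
qed

text \<open>The level is a parameter separate from the radius because in the sum both factors are
  cut at the same level, which may exceed the radius of one of them.\<close>

definition sublevel :: "'a::real_normed_vector set \<Rightarrow> 'a set \<Rightarrow> real \<Rightarrow> 'a set"
  where "sublevel V F R = {v \<in> V. far_dist v F \<le> R}"

lemma cent_eq_sublevel:
  assumes "F \<in> CB"
  shows "cent V F = sublevel V F (rad V F)"
  using rad_le[OF assms] by (force simp: cent_def sublevel_def)

lemma sublevel_mono: "R \<le> S \<Longrightarrow> sublevel V F R \<subseteq> sublevel V F S"
  by (auto simp: sublevel_def)

lemma sublevel_closed_bounded:
  assumes "F \<in> CB" "closed V"
  shows "closed (sublevel V F R)" "bounded (sublevel V F R)"
proof -
  \<comment> \<open>An intersection of \<open>V\<close> with closed balls yields closedness and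
    boundedness at once.\<close>
  have eq: "sublevel V F R = V \<inter> (\<Inter>z\<in>F. cball z R)"
    using CB_D[OF assms(1)] by (auto simp: sublevel_def far_dist_le_iff dist_norm norm_minus_commute)
  show "closed (sublevel V F R)"
    unfolding eq using assms by auto
  obtain z where "z \<in> F"
    using CB_D[OF assms(1)] by blast
  then have "sublevel V F R \<subseteq> cball z R"
    unfolding eq by blast
  then show "bounded (sublevel V F R)"
    using bounded_cball bounded_subset by blast
qed

text \<open>The farthest distance is convex along segments: going from \<open>v\<close> the fraction
  \<open>s / \<alpha>\<close> of the way to \<open>c\<close>, which lies lower by
  \<open>\<alpha>\<close>, gains exactly the overshoot \<open>s\<close>. Both ends are within
  \<open>R + s\<close> of any point of \<open>F\<close>, hence at most \<open>2 * (R + s)\<close>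
  apart, which bounds the displacement.\<close>

lemma push_into_sublevel:
  assumes "convex V" "F \<in> CB" "v \<in> V" "c \<in> V" "0 \<le> s" "s \<le> \<alpha>" "0 < \<alpha>"
    and v: "far_dist v F \<le> R + s" and c: "far_dist c F \<le> R + s - \<alpha>"
  shows "\<exists>w\<in>sublevel V F R. norm (v - w) \<le> s / \<alpha> * (2 * (R + s))"
proof -
  define l where "l = s / \<alpha>"
  have l: "0 \<le> l" "l \<le> 1" "l * \<alpha> = s"
    using assms by (auto simp: l_def)
  define w where "w = (1 - l) *\<^sub>R v + l *\<^sub>R c"
  have "w \<in> V"
    unfolding w_def using assms l by (intro convexD) auto
  have F: "norm (v - z) \<le> R + s" "norm (c - z) \<le> R + s - \<alpha>" if "z \<in> F" for z
    using v c norm_le_far_dist[of F z] CB_D[OF assms(2)] that by (meson order_trans)+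
  have "norm (w - z) \<le> R" if "z \<in> F" for z
  proof -
    have "w - z = (1 - l) *\<^sub>R (v - z) + l *\<^sub>R (c - z)"
      by (simp add: w_def algebra_simps)
    then have "norm (w - z) \<le> (1 - l) * norm (v - z) + l * norm (c - z)"
      using norm_triangle_ineq[of "(1 - l) *\<^sub>R (v - z)" "l *\<^sub>R (c - z)"] l by simp
    also have "\<dots> \<le> (1 - l) * (R + s) + l * (R + s - \<alpha>)"
      using l F[OF that] by (intro add_mono mult_left_mono) auto
    also have "\<dots> = R"
      using l by (simp add: algebra_simps)
    finally show ?thesis .
  qed
  then have "w \<in> sublevel V F R"
    using \<open>w \<in> V\<close> CB_D[OF assms(2)] by (simp add: sublevel_def far_dist_le_iff)
  moreover have "norm (v - w) \<le> l * (2 * (R + s))"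
  proof -
    obtain z where z: "z \<in> F"
      using CB_D[OF assms(2)] by blast
    have "norm (v - c) \<le> norm (v - z) + norm (c - z)"
      using norm_triangle_ineq4[of "v - z" "c - z"] by simp
    then have vc: "norm (v - c) \<le> 2 * (R + s)"
      using F[OF z] assms(7) by (smt (verit))
    have "v - w = l *\<^sub>R (v - c)"
      by (simp add: w_def algebra_simps)
    then have "norm (v - w) = l * norm (v - c)"
      using l by simp
    then show ?thesis
      using vc l by (simp add: mult_left_mono)
  qed
  ultimately show ?thesis
    unfolding l_def by blast
qed

section \<open>Continuity of sublevel sets in the set and the level\<close>

lemma sublevel_continuous_at_radius:
  assumes "property_P1 V CB" "hausdorff_continuous_on_CB (cent V)" "F \<in> CB" "\<epsilon> > 0"
  shows "\<exists>\<delta>>0. \<forall>G\<in>CB. \<forall>S. rad V G \<le> S \<longrightarrow> \<bar>S - rad V F\<bar> \<le> \<delta> \<longrightarrow>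
    F \<subseteq> enlarge G \<delta> \<longrightarrow> G \<subseteq> enlarge F \<delta> \<longrightarrow>
    sublevel V F (rad V F) \<subseteq> enlarge (sublevel V G S) \<epsilon> \<and>
    sublevel V G S \<subseteq> enlarge (sublevel V F (rad V F)) \<epsilon>"
proof -
  obtain d where d: "d > 0" "near_cent V F d \<subseteq> enlarge (cent V F) \<epsilon>"
    using assms unfolding property_P1_def by blast
  obtain e where e: "e > 0"
    "\<And>G. G \<in> CB \<Longrightarrow> hausdorff_dist G F < e \<Longrightarrow> hausdorff_dist (cent V G) (cent V F) < \<epsilon>"
    using assms(2-4) unfolding hausdorff_continuous_on_CB_def by blast
  have cent_CB: "cent V G \<in> CB" if "G \<in> CB" for G
    using assms(2) that unfolding hausdorff_continuous_on_CB_def by blast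
  \<comment> \<open>One \<open>\<delta>\<close> is spent on replacing \<open>G\<close> by
    \<open>F\<close> and one on replacing \<open>S\<close> by \<open>rad V F\<close>, hence
    \<open>d / 2\<close>; \<open>e / 2\<close> makes the Hausdorff bound strict.\<close>
  define \<delta> where "\<delta> = min (d / 2) (e / 2)"
  have \<delta>: "\<delta> > 0" "2 * \<delta> \<le> d" "\<delta> < e"
    using d(1) e(1) by (auto simp: \<delta>_def)
  show ?thesis
  proof (intro exI[of _ \<delta>] conjI ballI allI impI)
    fix G S
    assume G: "G \<in> CB" and S: "rad V G \<le> S" "\<bar>S - rad V F\<bar> \<le> \<delta>"
      and FG: "F \<subseteq> enlarge G \<delta>" "G \<subseteq> enlarge F \<delta>"
    have "hausdorff_dist G F < e"
      using hausdorff_dist_le[OF \<delta>(1) FG(2) FG(1)] \<delta> by simp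
    then obtain t where t: "0 < t" "t < \<epsilon>" "cent V F \<subseteq> enlarge (cent V G) t"
      using hausdorff_dist_lessD[OF cent_CB[OF G] cent_CB[OF assms(3)] e(2)[OF G]] by blast
    \<comment> \<open>Since \<open>rad V G \<le> S\<close>, the center of \<open>G\<close> lies
      inside the sublevel set of \<open>G\<close> at \<open>S\<close>.\<close>
    have "enlarge (cent V G) t \<subseteq> enlarge (sublevel V G S) \<epsilon>"
      unfolding cent_eq_sublevel[OF G] using t by (intro enlarge_mono sublevel_mono S(1)) auto
    with t show "sublevel V F (rad V F) \<subseteq> enlarge (sublevel V G S) \<epsilon>"
      by (simp add: cent_eq_sublevel[OF assms(3)])
    have "sublevel V G S \<subseteq> near_cent V F d"
    proof
      fix v
      assume "v \<in> sublevel V G S"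
      then show "v \<in> near_cent V F d"
        using far_dist_enlarge[OF assms(3) G \<delta>(1) FG(1), of v] S \<delta>
        by (auto simp: sublevel_def near_cent_def)
    qed
    with d(2) show "sublevel V G S \<subseteq> enlarge (sublevel V F (rad V F)) \<epsilon>"
      by (simp add: cent_eq_sublevel[OF assms(3)])
  qed (rule \<delta>)
qed

text \<open>A center \<open>c\<close> of \<open>F\<close> lies below the level by the margin
  \<open>\<alpha>\<close>, and this margin nearly survives small changes of set and level. So
  \<open>c\<close> is a target for \<open>push_into_sublevel\<close> in both inclusions.\<close>

lemma sublevel_continuous_above_radius:
  assumes "convex V" "cent V F \<noteq> {}" "F \<in> CB" "rad V F < R" "\<epsilon> > 0"
  shows "\<exists>\<delta>>0. \<forall>G\<in>CB. \<forall>S. \<bar>S - R\<bar> \<le> \<delta> \<longrightarrow>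
    F \<subseteq> enlarge G \<delta> \<longrightarrow> G \<subseteq> enlarge F \<delta> \<longrightarrow>
    sublevel V F R \<subseteq> enlarge (sublevel V G S) \<epsilon> \<and>
    sublevel V G S \<subseteq> enlarge (sublevel V F R) \<epsilon>"
proof -
  obtain c where c: "c \<in> V" "far_dist c F = rad V F"
    using assms(2) by (auto simp: cent_def)
  define \<alpha> where "\<alpha> = R - rad V F"
  have \<alpha>: "\<alpha> > 0"
    using assms by (simp add: \<alpha>_def)
  have "R + \<alpha> > 0"
    using assms(4) far_dist_nonneg[of F c] CB_D[OF assms(3)] c \<alpha> by auto
  \<comment> \<open>The overshoot is \<open>2 * \<delta>\<close>: one \<open>\<delta>\<close> for
    the set, one for the level. The first bound gives \<open>2 * \<delta> \<le> \<alpha>\<close> and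
    \<open>R + 3 * \<delta> \<le> R + \<alpha>\<close>; the second then keeps the displacement below
    \<open>\<epsilon>\<close>.\<close>
  define \<delta> where "\<delta> = min (\<alpha> / 4) (\<epsilon> * \<alpha> / (4 * (R + \<alpha>)))"
  have \<delta>: "\<delta> > 0" "4 * \<delta> \<le> \<alpha>"
    using \<alpha> \<open>R + \<alpha> > 0\<close> assms(5) by (auto simp: \<delta>_def)
  have "\<delta> \<le> \<epsilon> * \<alpha> / (4 * (R + \<alpha>))"
    by (simp add: \<delta>_def)
  then have \<delta>\<epsilon>: "2 * \<delta> / \<alpha> * (2 * (R + \<alpha>)) \<le> \<epsilon>"
    using \<alpha> \<open>R + \<alpha> > 0\<close> by (simp add: field_simps)
  have small: "2 * \<delta> / \<alpha> * (2 * (Q + 2 * \<delta>)) \<le> \<epsilon>" if "Q \<le> R + \<delta>" for Q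
  proof -
    have "2 * \<delta> / \<alpha> * (2 * (Q + 2 * \<delta>)) \<le> 2 * \<delta> / \<alpha> * (2 * (R + \<alpha>))"
      using that \<delta> \<alpha> by (intro mult_left_mono) auto
    with \<delta>\<epsilon> show ?thesis
      by linarith
  qed
  show ?thesis
  proof (intro exI[of _ \<delta>] conjI ballI allI impI)
    fix G S
    assume G: "G \<in> CB" and S: "\<bar>S - R\<bar> \<le> \<delta>"
      and FG: "F \<subseteq> enlarge G \<delta>" "G \<subseteq> enlarge F \<delta>"
    note far = far_dist_enlarge[OF assms(3) G \<delta>(1) FG(1)] far_dist_enlarge[OF G assms(3) \<delta>(1) FG(2)]
    show "sublevel V F R \<subseteq> enlarge (sublevel V G S) \<epsilon>"
    proof
      fix v
      assume "v \<in> sublevel V F R"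
      then have "\<exists>w\<in>sublevel V G S. norm (v - w) \<le> 2 * \<delta> / \<alpha> * (2 * (S + 2 * \<delta>))"
        using c far(2)[of v] far(2)[of c] S \<delta> \<alpha>
        by (intro push_into_sublevel[OF assms(1) G, of v c])
          (auto simp: sublevel_def \<alpha>_def)
      then show "v \<in> enlarge (sublevel V G S) \<epsilon>"
        using small[of S] S assms(5) by (force simp: mem_enlarge_iff)
    qed
    show "sublevel V G S \<subseteq> enlarge (sublevel V F R) \<epsilon>"
    proof
      fix v
      assume "v \<in> sublevel V G S"
      then have "\<exists>w\<in>sublevel V F R. norm (v - w) \<le> 2 * \<delta> / \<alpha> * (2 * (R + 2 * \<delta>))"
        using c far(1)[of v] S \<delta> \<alpha>
        by (intro push_into_sublevel[OF assms(1,3), of v c])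
          (auto simp: sublevel_def \<alpha>_def)
      then show "v \<in> enlarge (sublevel V F R) \<epsilon>"
        using small[of R] \<delta> assms(5) by (force simp: mem_enlarge_iff)
    qed
  qed (rule \<delta>)
qed

lemma sublevel_continuous:
  assumes "convex V" "property_P1 V CB" "hausdorff_continuous_on_CB (cent V)"
    and "F \<in> CB" "rad V F \<le> R" "\<epsilon> > 0"
  shows "\<exists>\<delta>>0. \<forall>G\<in>CB. \<forall>S. rad V G \<le> S \<longrightarrow> \<bar>S - R\<bar> \<le> \<delta> \<longrightarrow>
    F \<subseteq> enlarge G \<delta> \<longrightarrow> G \<subseteq> enlarge F \<delta> \<longrightarrow>
    sublevel V F R \<subseteq> enlarge (sublevel V G S) \<epsilon> \<and>
    sublevel V G S \<subseteq> enlarge (sublevel V F R) \<epsilon>"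
\<comment> \<open>At the radius no point of \<open>V\<close> lies strictly below the level, so the
  segment argument has no target there.\<close>
proof (cases "R = rad V F")
  case True
  then show ?thesis
    using sublevel_continuous_at_radius[OF assms(2-4,6)] by simp
next
  case False
  have "cent V F \<noteq> {}"
    using assms(2,4) by (auto simp: property_P1_def rcp_def)
  then show ?thesis
    using sublevel_continuous_above_radius[OF assms(1) _ assms(4) _ assms(6), of R] False assms(5)
    by (metis order_le_imp_less_or_eq)
qed

section \<open>The maximum-norm sum\<close>

lemma bounded_linear_sfst: "bounded_linear sfst"
  by (rule bounded_linear_intro[where K = 1]) (auto simp: norm_sup_sum_def)

lemma bounded_linear_ssnd: "bounded_linear ssnd"
  by (rule bounded_linear_intro[where K = 1]) (auto simp: norm_sup_sum_def)

lemma mem_sup_Times_iff: "v \<in> A \<times>\<^sub>\<infinity> B \<longleftrightarrow> sfst v \<in> A \<and> ssnd v \<in> B"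
  by (cases v) (auto simp: sup_Times_def)

lemma closed_sup_Times:
  assumes "closed A" "closed B"
  shows "closed (A \<times>\<^sub>\<infinity> B)"
proof -
  have "A \<times>\<^sub>\<infinity> B = sfst -` A \<inter> ssnd -` B"
    by (auto simp: mem_sup_Times_iff)
  then show ?thesis
    using assms
    by (simp add: closed_Int continuous_closed_vimage linear_continuous_at
        bounded_linear_sfst bounded_linear_ssnd)
qed

text \<open>In the maximum norm, coordinatewise errors of at most \<open>t\<close> combine to an
  error of at most the same \<open>t\<close>.\<close>

lemma sup_Times_subset_enlarge:
  assumes "A \<subseteq> enlarge C t" "B \<subseteq> enlarge D t" "t > 0"
  shows "A \<times>\<^sub>\<infinity> B \<subseteq> enlarge (C \<times>\<^sub>\<infinity> D) t"
proof
  fix v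
  assume "v \<in> A \<times>\<^sub>\<infinity> B"
  then have "sfst v \<in> enlarge C t" "ssnd v \<in> enlarge D t"
    using assms by (auto simp: mem_sup_Times_iff)
  then obtain c d where "c \<in> C" "norm (sfst v - c) \<le> t" "d \<in> D" "norm (ssnd v - d) \<le> t"
    using assms(3) by (auto simp: mem_enlarge_iff)
  then show "v \<in> enlarge (C \<times>\<^sub>\<infinity> D) t"
    using assms(3)
    by (auto simp: mem_enlarge_iff mem_sup_Times_iff norm_sup_sum_def intro!: bexI[of _ "SupPair c d"])
qed

section \<open>Projections of closed bounded sets, and radii in the sum\<close>

lemma closure_image_CB:
  assumes "bounded_linear f" "F \<in> CB"
  shows "closure (f ` F) \<in> CB"
  using assms bounded_linear_image[of F f] by (auto simp: CB_def)

text \<open>The slack \<open>t - s\<close> pays for approximating a point of the closure by an image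
  point; the non-expansive \<open>f\<close> carries over the remaining \<open>s\<close>.\<close>

lemma closure_image_subset_enlarge:
  assumes "\<And>x y. norm (f x - f y) \<le> norm (x - y)" "F \<subseteq> enlarge G s" "0 < s" "s < t"
  shows "closure (f ` F) \<subseteq> enlarge (closure (f ` G)) t"
proof
  fix x
  assume "x \<in> closure (f ` F)"
  moreover have "t - s > 0"
    using assms by simp
  ultimately obtain y where y: "y \<in> F" "dist (f y) x < t - s"
    unfolding closure_approachable by blast
  then have "y \<in> enlarge G s"
    using assms by blast
  then obtain g where g: "g \<in> G" "norm (y - g) \<le> s"
    using assms(3) by (auto simp: mem_enlarge_iff)
  have "norm (x - f g) \<le> norm (x - f y) + norm (f y - f g)"
    using norm_triangle_ineq[of "x - f y" "f y - f g"] by simp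
  also have "\<dots> \<le> t"
    using y g assms(1)[of y g] by (simp add: dist_norm norm_minus_commute)
  finally have "norm (x - f g) \<le> t" .
  moreover have "f g \<in> closure (f ` G)"
    using g closure_subset[of "f ` G"] by auto
  ultimately show "x \<in> enlarge (closure (f ` G)) t"
    using assms(3,4) by (auto simp: mem_enlarge_iff)
qed

text \<open>A closed ball contains a set exactly when it contains its closure.\<close>

lemma far_dist_closure_le_iff:
  assumes "F \<noteq> {}" "bounded F"
  shows "far_dist v (closure F) \<le> R \<longleftrightarrow> (\<forall>z\<in>F. norm (v - z) \<le> R)"
proof -
  have "closure F \<subseteq> cball v R \<longleftrightarrow> F \<subseteq> cball v R"
    using closure_minimal[of F "cball v R"] closure_subset[of F] by auto
  then show ?thesis
    using assms by (simp add: far_dist_le_iff bounded_closure subset_iff dist_norm Ball_def)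
qed

text \<open>A maximum is at most \<open>R\<close> iff both entries are, and each entry sees only one
  projection of \<open>F\<close>.\<close>

lemma far_dist_sup_sum_le_iff:
  assumes "F \<in> CB"
  shows "far_dist v F \<le> R \<longleftrightarrow>
    far_dist (sfst v) (closure (sfst ` F)) \<le> R \<and> far_dist (ssnd v) (closure (ssnd ` F)) \<le> R"
  using CB_D[OF assms] bounded_linear_image[OF _ bounded_linear_sfst, of F]
    bounded_linear_image[OF _ bounded_linear_ssnd, of F]
  by (auto simp: far_dist_closure_le_iff far_dist_le_iff norm_sup_sum_def)

lemma sublevel_sup_Times:
  assumes "F \<in> CB"
  shows "sublevel (V \<times>\<^sub>\<infinity> W) F R =
    sublevel V (closure (sfst ` F)) R \<times>\<^sub>\<infinity> sublevel W (closure (ssnd ` F)) R"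
  by (auto simp: sublevel_def mem_sup_Times_iff far_dist_sup_sum_le_iff[OF assms])

lemma rad_sup_Times:
  assumes "F \<in> CB"
    and "cent V (closure (sfst ` F)) \<noteq> {}" "cent W (closure (ssnd ` F)) \<noteq> {}"
  shows "rad (V \<times>\<^sub>\<infinity> W) F = max (rad V (closure (sfst ` F))) (rad W (closure (ssnd ` F)))"
    (is "_ = max ?r1 ?r2")
proof (rule antisym)
  \<comment> \<open>A pair of centers attains the larger of the two radii.\<close>
  obtain a b where "a \<in> V" "far_dist a (closure (sfst ` F)) = ?r1"
    "b \<in> W" "far_dist b (closure (ssnd ` F)) = ?r2"
    using assms(2,3) by (auto simp: cent_def)
  then have ab: "SupPair a b \<in> V \<times>\<^sub>\<infinity> W" "far_dist (SupPair a b) F \<le> max ?r1 ?r2"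
    by (simp_all add: mem_sup_Times_iff far_dist_sup_sum_le_iff[OF assms(1)])
  then show "rad (V \<times>\<^sub>\<infinity> W) F \<le> max ?r1 ?r2"
    using rad_le[OF assms(1) ab(1)] by linarith
  have "max ?r1 ?r2 \<le> far_dist v F" if "v \<in> V \<times>\<^sub>\<infinity> W" for v
    using that far_dist_sup_sum_le_iff[OF assms(1), of v "far_dist v F"]
      rad_le[OF closure_image_CB[OF bounded_linear_sfst assms(1)], of "sfst v" V]
      rad_le[OF closure_image_CB[OF bounded_linear_ssnd assms(1)], of "ssnd v" W]
    by (auto simp: mem_sup_Times_iff)
  then show "max ?r1 ?r2 \<le> rad (V \<times>\<^sub>\<infinity> W) F"
    unfolding rad_def[of "V \<times>\<^sub>\<infinity> W"] using ab(1) by (intro cINF_greatest) auto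
qed

theorem proposition4p3:
  fixes V1 :: "'a::banach set" and V2 :: "'b::banach set"
  assumes "V1 \<noteq> {}" "closed V1" "convex V1" "property_P1 V1 CB"
    and "V2 \<noteq> {}" "closed V2" "convex V2" "property_P1 V2 CB"
    and "hausdorff_continuous_on_CB (cent V1)"
    and "hausdorff_continuous_on_CB (cent V2)"
  shows "hausdorff_continuous_on_CB (cent (V1 \<times>\<^sub>\<infinity> V2))"
proof -
  let ?V = "V1 \<times>\<^sub>\<infinity> V2"
  \<comment> \<open>A projection of a closed set need not be closed; the closure brings it back into
    \<open>CB\<close>, where the hypotheses on the factors apply.\<close>
  define P1 :: "('a, 'b) sup_sum set \<Rightarrow> 'a set" where "P1 F = closure (sfst ` F)" for F
  define P2 :: "('a, 'b) sup_sum set \<Rightarrow> 'b set" where "P2 F = closure (ssnd ` F)" for F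
  define R where "R F = max (rad V1 (P1 F)) (rad V2 (P2 F))" for F
  have P: "P1 F \<in> CB" "P2 F \<in> CB" if "F \<in> CB" for F
    using that unfolding P1_def P2_def
    by (auto intro: closure_image_CB bounded_linear_sfst bounded_linear_ssnd)
  have ne: "cent V1 F \<noteq> {}" "cent V2 G \<noteq> {}" if "F \<in> CB" "G \<in> CB" for F G
    using assms(4,8) that by (auto simp: property_P1_def rcp_def)
  have rad: "rad ?V F = R F" if "F \<in> CB" for F
    using rad_sup_Times[OF that] ne P[OF that] by (simp add: R_def P1_def P2_def)
  have cent: "cent ?V F = sublevel V1 (P1 F) (R F) \<times>\<^sub>\<infinity> sublevel V2 (P2 F) (R F)"
    if "F \<in> CB" for F
    unfolding cent_eq_sublevel[OF that] rad[OF that] sublevel_sup_Times[OF that] P1_def P2_def ..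
  have "cent ?V F \<in> CB" if F: "F \<in> CB" for F
  proof -
    \<comment> \<open>The common level \<open>R F\<close> is at least both radii, so both factors of
      the product contain centers.\<close>
    obtain a b where "a \<in> cent V1 (P1 F)" "b \<in> cent V2 (P2 F)"
      using ne P[OF F] by blast
    then have "SupPair a b \<in> cent ?V F"
      unfolding cent[OF F] by (auto simp: mem_sup_Times_iff cent_def sublevel_def R_def)
    moreover have "closed (cent ?V F)" "bounded (cent ?V F)"
      unfolding cent_eq_sublevel[OF F]
      using sublevel_closed_bounded[OF F closed_sup_Times[OF assms(2,6)]] by blast+
    ultimately show ?thesis
      by (auto simp: CB_def)
  qed
  moreover have "\<exists>\<delta>>0. \<forall>G\<in>CB. hausdorff_dist G F < \<delta> \<longrightarrow> hausdorff_dist (cent ?V G) (cent ?V F) < \<epsilon>"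
    if F: "F \<in> CB" and \<epsilon>: "\<epsilon> > 0" for F \<epsilon>
  proof -
    \<comment> \<open>Halving \<open>\<epsilon>\<close> turns the final non-strict Hausdorff bound
      into a strict one.\<close>
    have "\<epsilon> / 2 > 0" "rad V1 (P1 F) \<le> R F" "rad V2 (P2 F) \<le> R F"
      using \<epsilon> by (auto simp: R_def)
    note R = this
    obtain d1 where d1: "d1 > 0" "\<forall>G\<in>CB. \<forall>S. rad V1 G \<le> S \<longrightarrow> \<bar>S - R F\<bar> \<le> d1 \<longrightarrow>
        P1 F \<subseteq> enlarge G d1 \<longrightarrow> G \<subseteq> enlarge (P1 F) d1 \<longrightarrow>
        sublevel V1 (P1 F) (R F) \<subseteq> enlarge (sublevel V1 G S) (\<epsilon> / 2) \<and>
        sublevel V1 G S \<subseteq> enlarge (sublevel V1 (P1 F) (R F)) (\<epsilon> / 2)"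
      using sublevel_continuous[OF assms(3,4,9) P(1)[OF F] R(2,1)] by (elim exE conjE)
    obtain d2 where d2: "d2 > 0" "\<forall>G\<in>CB. \<forall>S. rad V2 G \<le> S \<longrightarrow> \<bar>S - R F\<bar> \<le> d2 \<longrightarrow>
        P2 F \<subseteq> enlarge G d2 \<longrightarrow> G \<subseteq> enlarge (P2 F) d2 \<longrightarrow>
        sublevel V2 (P2 F) (R F) \<subseteq> enlarge (sublevel V2 G S) (\<epsilon> / 2) \<and>
        sublevel V2 G S \<subseteq> enlarge (sublevel V2 (P2 F) (R F)) (\<epsilon> / 2)"
      using sublevel_continuous[OF assms(7,8,10) P(2)[OF F] R(3,1)] by (elim exE conjE)
    define \<delta> where "\<delta> = min d1 d2"
    have \<delta>: "\<delta> > 0" "\<delta> \<le> d1" "\<delta> \<le> d2"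
      using d1(1) d2(1) by (auto simp: \<delta>_def)
    have "hausdorff_dist (cent ?V G) (cent ?V F) < \<epsilon>"
      if G: "G \<in> CB" and GF: "hausdorff_dist G F < \<delta>" for G
    proof -
      obtain t where t: "0 < t" "t < \<delta>" "G \<subseteq> enlarge F t" "F \<subseteq> enlarge G t"
        using hausdorff_dist_lessD[OF G F GF] by blast
      \<comment> \<open>The strict inequality \<open>t < \<delta>\<close> is the slack consumed by
        the closures.\<close>
      have proj: "P1 A \<subseteq> enlarge (P1 B) e" "P2 A \<subseteq> enlarge (P2 B) e"
        if "A \<subseteq> enlarge B t" "\<delta> \<le> e" for A B e
        unfolding P1_def P2_def using that t
        by (intro closure_image_subset_enlarge[of _ A B t e]; simp add: norm_sup_sum_def)+
      note PF = P[OF F] and PG = P[OF G] and FG = proj[OF t(4) order_refl] and GF = proj[OF t(3) order_refl]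
      \<comment> \<open>Each radius moves by at most \<open>\<delta>\<close>, hence so does the
        maximum \<open>R\<close>.\<close>
      have "rad V1 (P1 G) \<le> rad V1 (P1 F) + \<delta>" "rad V1 (P1 F) \<le> rad V1 (P1 G) + \<delta>"
        using rad_enlarge[OF PG(1) PF(1) \<delta>(1) GF(1) ne(1)[OF PF]]
          rad_enlarge[OF PF(1) PG(1) \<delta>(1) FG(1) ne(1)[OF PG]] by blast+
      moreover have "rad V2 (P2 G) \<le> rad V2 (P2 F) + \<delta>" "rad V2 (P2 F) \<le> rad V2 (P2 G) + \<delta>"
        using rad_enlarge[OF PG(2) PF(2) \<delta>(1) GF(2) ne(2)[OF PF]]
          rad_enlarge[OF PF(2) PG(2) \<delta>(1) FG(2) ne(2)[OF PG]] by blast+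
      ultimately have "\<bar>R G - R F\<bar> \<le> \<delta>"
        unfolding R_def by linarith
      then have RG: "\<bar>R G - R F\<bar> \<le> d1" "\<bar>R G - R F\<bar> \<le> d2" "rad V1 (P1 G) \<le> R G" "rad V2 (P2 G) \<le> R G"
        using \<delta> by (auto simp: R_def)
      \<comment> \<open>The level \<open>S\<close> is instantiated with \<open>R G\<close>, the
        radius of \<open>G\<close> in the sum, so these sublevel sets are the factors of the center
        of \<open>G\<close>.\<close>
      note s1 = d1(2)[rule_format, OF P(1)[OF G] RG(3,1) proj(1)[OF t(4) \<delta>(2)] proj(1)[OF t(3) \<delta>(2)]]
      note s2 = d2(2)[rule_format, OF P(2)[OF G] RG(4,2) proj(2)[OF t(4) \<delta>(3)] proj(2)[OF t(3) \<delta>(3)]]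
      have "hausdorff_dist (cent ?V G) (cent ?V F) \<le> \<epsilon> / 2"
        unfolding cent[OF F] cent[OF G] using s1 s2 \<epsilon>
        by (intro hausdorff_dist_le sup_Times_subset_enlarge) auto
      with \<epsilon> show ?thesis
        by linarith
    qed
    with \<delta>(1) show ?thesis
      by blast
  qed
  ultimately show ?thesis
    unfolding hausdorff_continuous_on_CB_def by blast
qed

end
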